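(* For every positive integer $n$, $$\lfloor n/2\rfloor!\;\leq\; \hat{M}(n,4)\;\leq\; (2\sqrt{3})^n\,\lceil n/2 \rceil!\,,$$ where $\hat{M}(n,4)$ denotes the maximum cardinality of a family of (undirected) Hamilton paths in the complete graph $K_n$ such that for any two distinct members $P,Q$ of the family, the union of $P$ and $Q$ contains a cycle of length four which is the union of a subpath of $P$ and a subpath of $Q$.
   Context: $K_n$ is the complete graph with vertex set $[n]=\{1,\dots,n\}$. Hamilton paths in $K_n$ are undirected and regarded as subgraphs, so a path and its reversal are the same. The union of two graphs on the same vertex set is the graph on that vertex set whose edge set is the union of the two edge sets. The condition that a 4-cycle is the union of a subpath of $P$ and a subpath of $Q$ means that its edges can be split into a path whose edges all belong to $P$ and a path whose edges all belong to $Q$: either two edges forming a path from each of $P$ and $Q$, or one edge from one of them and a path of three edges from the other. *)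

theory Defs
  imports Complex_Main
begin

text \<open>
  All graphs have vertex set \<open>{1..n}\<close> and are represented by their edge sets; an edge is a
  two-element set of vertices. A Hamilton path is a spanning subgraph, so it is determined by its
  edge set; a vertex sequence and its reversal yield the same edge set.
\<close>

definition complete_edges :: "nat \<Rightarrow> nat set set" where
  "complete_edges n = {e. e \<subseteq> {1..n} \<and> card e = 2}"

definition path_edges :: "nat list \<Rightarrow> nat set set" where
  "path_edges vs = {{vs ! i, vs ! Suc i} | i. Suc i < length vs}"

definition is_path :: "nat set set \<Rightarrow> bool" where
  "is_path E \<longleftrightarrow> (\<exists>vs. vs \<noteq> [] \<and> distinct vs \<and> E = path_edges vs)"

definition subpath :: "nat set set \<Rightarrow> nat set set \<Rightarrow> bool" where
  "subpath S P \<longleftrightarrow> is_path S \<and> S \<subseteq> P"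

definition hamilton_paths :: "nat \<Rightarrow> nat set set set" where
  "hamilton_paths n =
     {E. E \<subseteq> complete_edges n \<and> (\<exists>vs. distinct vs \<and> set vs = {1..n} \<and> E = path_edges vs)}"

definition is_cycle :: "nat \<Rightarrow> nat set set \<Rightarrow> bool" where
  "is_cycle k C \<longleftrightarrow>
     (\<exists>vs. 3 \<le> k \<and> length vs = k \<and> distinct vs \<and> C = insert {last vs, hd vs} (path_edges vs))"

definition cycle_compatible :: "nat \<Rightarrow> nat set set \<Rightarrow> nat set set \<Rightarrow> bool" where
  "cycle_compatible k P Q \<longleftrightarrow>
     (\<exists>C. is_cycle k C \<and> C \<subseteq> P \<union> Q \<and>
          (\<exists>S T. subpath S P \<and> subpath T Q \<and> S \<inter> T = {} \<and> C = S \<union> T))"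

definition compatible_families :: "nat \<Rightarrow> nat \<Rightarrow> nat set set set set" where
  "compatible_families n k =
     {F. F \<subseteq> hamilton_paths n \<and> (\<forall>P\<in>F. \<forall>Q\<in>F. P \<noteq> Q \<longrightarrow> cycle_compatible k P Q)}"

definition M_hat :: "nat \<Rightarrow> nat \<Rightarrow> nat" where
  "M_hat n k = Max (card ` compatible_families n k)"

text \<open>The maximum ranges over a finite nonempty set, so it is attained.\<close>

lemma finite_hamilton_paths: "finite (hamilton_paths n)"
proof -
  have "hamilton_paths n \<subseteq> Pow (Pow {1..n})"
    unfolding hamilton_paths_def complete_edges_def by blast
  then show ?thesis
    by (rule finite_subset) simp
qed

lemma finite_compatible_families: "finite (compatible_families n k)"
proof -
  have "compatible_families n k \<subseteq> Pow (hamilton_paths n)"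
    unfolding compatible_families_def by blast
  then show ?thesis
    by (rule finite_subset) (simp add: finite_hamilton_paths)
qed

lemma empty_in_compatible_families: "{} \<in> compatible_families n k"
  unfolding compatible_families_def by simp

lemma M_hat_attained: "\<exists>F\<in>compatible_families n k. card F = M_hat n k"
proof -
  have "M_hat n k \<in> card ` compatible_families n k"
    unfolding M_hat_def
    using finite_compatible_families [of n k] empty_in_compatible_families [of n k]
    by (intro Max_in) blast+
  then show ?thesis
    by auto
qed

lemma card_le_M_hat: "F \<in> compatible_families n k \<Longrightarrow> card F \<le> M_hat n k"
  unfolding M_hat_def using finite_compatible_families by (intro Max_ge) auto

end

theory Submission
  imports Defs "HOL-Combinatorics.Permutations" "HOL-Library.FuncSet"
begin

text \<open>
  Lower bound. Put the vertices \<open>1, 3, 5, \<dots>\<close> in increasing order on every other place of a path and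
  fill the gaps with \<open>2, 4, 6, \<dots>\<close> in any of the \<open>\<lfloor>n/2\<rfloor>!\<close> orders. Two different fillings
  differ in some gap that has a fixed vertex on both sides; these two fixed vertices and the two
  fillers form a 4-cycle, half of it from each path (\<open>fixed_evens_compatible\<close>).

  Upper bound. Let \<open>R\<close> be a set of vertex sequences whose paths are distinct and pairwise
  incompatible. The same holds for every relabelling of \<open>R\<close>, so a compatible family \<open>F\<close> contains at
  most one path of each relabelling. On the other hand, as the relabelling runs through all \<open>n!\<close>
  permutations, each member of \<open>R\<close> hits each path of \<open>F\<close> at least once. Counting the hits gives
  \<open>card F * card R \<le> n!\<close>, and it remains to find a large \<open>R\<close>.

  Let \<open>m = \<lfloor>n/2\<rfloor>\<close>, number the vertices from \<open>0\<close>, and cut \<open>0, \<dots>, 2m - 1\<close> into the blocks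
  \<open>(2i, 2i + 1)\<close>. The members of \<open>R\<close> arrange the blocks in such a way that the index of a block is
  kept modulo \<open>3\<close>; a last vertex left over when \<open>n\<close> is odd stays in its place. Hence the vertex \<open>v\<close>
  is always at a place congruent to \<open>v\<close> modulo \<open>6\<close>, and every step of a path raises the residue
  modulo \<open>6\<close> by one. Around a 4-cycle the changes \<open>1\<close> and \<open>-1\<close> sum to a multiple of \<open>6\<close>,
  hence to \<open>0\<close>. Three consecutive edges of one path contribute \<open>3\<close> or \<open>-3\<close>, which the
  fourth edge cannot cancel. If two consecutive edges \<open>u, v, w\<close> come from one path and
  \<open>u, x, w\<close> from the other, both run in the same direction, say from \<open>u\<close> to \<open>w\<close>; but one of the
  two edges \<open>uv\<close>, \<open>vw\<close> lies inside a block and is therefore common to both paths, so that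
  \<open>v = x\<close> (\<open>layered_paths_incompatible\<close>).

  The number of such arrangements is at least \<open>m!/3^m\<close>, since a permutation of the blocks colours the
  places with residues modulo \<open>3\<close>, and all permutations with the same colouring form a coset of
  the residue preserving ones. Altogether \<open>card F \<le> 3^m n!/m! = 3^m (n choose m) (n - m)!\<close>, which is
  at most \<open>3^m 2^n (n - m)!\<close>, and \<open>3^m \<le> (sqrt 3)^n\<close>.
\<close>

section \<open>Hamilton paths as permutations\<close>

lemma path_edges_simps:
  "path_edges [x] = {}"
  "path_edges (x # y # zs) = insert {x, y} (path_edges (y # zs))"
proof -
  show "path_edges [x] = {}" by (simp add: path_edges_def)
  show "path_edges (x # y # zs) = insert {x, y} (path_edges (y # zs))" (is "?L = ?R")
  proof (intro equalityI subsetI)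
    fix e assume "e \<in> ?L"
    then obtain i where "Suc i < length (x # y # zs)"
      "e = {(x # y # zs) ! i, (x # y # zs) ! Suc i}"
      unfolding path_edges_def by blast
    then show "e \<in> ?R" by (cases i) (auto simp: path_edges_def)
  next
    fix e assume e: "e \<in> ?R"
    show "e \<in> ?L"
    proof (cases "e = {x, y}")
      case True
      then show ?thesis unfolding path_edges_def by (auto intro!: exI[of _ 0])
    next
      case False
      with e obtain i where "Suc i < length (y # zs)" "e = {(y # zs) ! i, (y # zs) ! Suc i}"
        unfolding path_edges_def by auto
      then show ?thesis unfolding path_edges_def by (auto intro!: exI[of _ "Suc i"])
    qed
  qed
qed

text \<open>
  Sequences take values in \<open>{..<n}\<close>, which keeps places and residues aligned; the vertices of the
  graph are their successors.
\<close>

definition seq_path :: "nat \<Rightarrow> (nat \<Rightarrow> nat) \<Rightarrow> nat set set" where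
  "seq_path n s = {{Suc (s i), Suc (s (Suc i))} | i. Suc i < n}"

lemma seq_pathI: "Suc i < n \<Longrightarrow> {Suc (s i), Suc (s (Suc i))} \<in> seq_path n s"
  unfolding seq_path_def by blast

lemma seq_path_eq_path_edges: "seq_path n s = path_edges (map (\<lambda>i. Suc (s i)) [0..<n])"
  unfolding seq_path_def path_edges_def by (intro Collect_cong ex_cong1) auto

lemma seq_path_hamilton:
  assumes "s permutes {..<n}"
  shows "seq_path n s \<in> hamilton_paths n"
proof -
  have inj: "s i = s j \<longleftrightarrow> i = j" for i j
    using permutes_inj[OF assms] by (auto dest: injD)
  have lt: "s i < n \<longleftrightarrow> i < n" for i
    using permutes_in_image[OF assms, of i] by simp
  have "(\<lambda>i. Suc (s i)) ` {..<n} = Suc ` s ` {..<n}" by auto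
  also have "\<dots> = {1..n}"
    using permutes_image[OF assms] by (simp add: lessThan_atLeast0 atLeastLessThanSuc_atLeastAtMost)
  finally have "set (map (\<lambda>i. Suc (s i)) [0..<n]) = {1..n}"
    by (simp add: lessThan_atLeast0)
  moreover have "distinct (map (\<lambda>i. Suc (s i)) [0..<n])"
    by (simp add: distinct_map inj_on_def inj)
  moreover have "seq_path n s \<subseteq> complete_edges n"
    unfolding seq_path_def complete_edges_def by (auto simp: inj lt Suc_le_eq card_insert_if)
  ultimately show ?thesis
    unfolding hamilton_paths_def seq_path_eq_path_edges by blast
qed

lemma hamilton_path_obtains_permutation:
  assumes "P \<in> hamilton_paths n"
  obtains s where "s permutes {..<n}" "P = seq_path n s"
proof -
  obtain vs where d: "distinct vs" and st: "set vs = {1..n}" and P: "P = path_edges vs"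
    using assms unfolding hamilton_paths_def by blast
  have len: "length vs = n" using distinct_card[OF d] st by simp
  have range: "1 \<le> vs ! i \<and> vs ! i \<le> n" if "i < n" for i
    using nth_mem[of i vs] that len st by auto
  define s where "s i = (if i < n then vs ! i - 1 else i)" for i
  have Suc_s: "Suc (s i) = vs ! i" if "i < n" for i
    using range[OF that] that by (simp add: s_def)
  have inj: "inj_on s {..<n}"
  proof (rule inj_onI)
    fix i j assume "i \<in> {..<n}" "j \<in> {..<n}" "s i = s j"
    then have "vs ! i = vs ! j" "i < n" "j < n" using Suc_s[of i] Suc_s[of j] by auto
    then show "i = j" using nth_eq_iff_index_eq[OF d] len by blast
  qed
  have into: "s ` {..<n} \<subseteq> {..<n}"
  proof
    fix v assume "v \<in> s ` {..<n}"
    then obtain i where "i < n" "v = s i" by auto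
    then show "v \<in> {..<n}" using Suc_s[of i] range[of i] by simp
  qed
  have "s permutes {..<n}"
    by (rule bij_imp_permutes)
      (use inj endo_inj_surj[OF _ into inj] in \<open>auto simp: bij_betw_def s_def\<close>)
  moreover have "P = seq_path n s"
    unfolding P path_edges_def seq_path_def len
    by (intro Collect_cong ex_cong1) (auto simp: Suc_s)
  ultimately show thesis by (rule that)
qed

text \<open>
  Walking along the path from a known first vertex, the next vertex is the neighbour that was not
  visited just before.
\<close>

lemma seq_path_determines_sequence:
  assumes s: "inj s" and t: "inj t"
    and eq: "seq_path n s = seq_path n t" and start: "s 0 = t 0"
  shows "i < n \<Longrightarrow> s i = t i"
proof (induction i rule: less_induct)
  case (less i)
  show ?case
  proof (cases i)
    case 0
    then show ?thesis using start by simp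
  next
    case (Suc j)
    have sj: "s j = t j" using less Suc by simp
    have "{Suc (s j), Suc (s (Suc j))} \<in> seq_path n t"
      using seq_pathI[of j n s] less.prems Suc eq by simp
    then obtain k where "{Suc (s j), Suc (s (Suc j))} = {Suc (t k), Suc (t (Suc k))}"
      unfolding seq_path_def by blast
    then consider "t j = t k" "s (Suc j) = t (Suc k)" | "t j = t (Suc k)" "s (Suc j) = t k"
      using sj by (auto simp: doubleton_eq_iff)
    then show ?thesis
    proof cases
      case 1
      then show ?thesis using Suc injD[OF t, of j k] by simp
    next
      case 2
      then have "j = Suc k" using injD[OF t] by blast
      moreover from this have "s k = t k" using less Suc by simp
      ultimately have "s (Suc j) = s k" using 2 by simp
      then have "Suc j = k" using injD[OF s] by blast
      with \<open>j = Suc k\<close> show ?thesis by simp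
    qed
  qed
qed

section \<open>The lower bound\<close>

definition fixed_evens :: "(nat \<Rightarrow> nat) \<Rightarrow> nat \<Rightarrow> nat" where
  "fixed_evens \<pi> p = (if even p then p else Suc (2 * \<pi> (p div 2)))"

lemma fixed_evens_permutes:
  assumes "\<pi> permutes {..<n div 2}"
  shows "fixed_evens \<pi> permutes {..<n}"
proof -
  have inv: "fixed_evens \<rho> (fixed_evens \<rho>' p) = p" if "\<And>i. \<rho> (\<rho>' i) = i" for \<rho> \<rho>' p
    using that by (auto simp: fixed_evens_def)
  have "bij (fixed_evens \<pi>)"
    by (rule o_bij[where g = "fixed_evens (inv \<pi>)"])
      (auto simp: fun_eq_iff inv permutes_inverses[OF assms])
  moreover have "fixed_evens \<pi> p = p" if "p \<notin> {..<n}" for p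
  proof -
    have "p div 2 \<notin> {..<n div 2}" using that by auto
    then have "\<pi> (p div 2) = p div 2" using assms by (simp add: permutes_not_in)
    then show ?thesis by (simp add: fixed_evens_def)
  qed
  ultimately show ?thesis
    by (simp add: permutes_def bij_iff)
qed

text \<open>
  Two different permutations disagree in at least two places, hence in one that is not the last. This
  matters because for even \<open>n\<close> the last gap has a fixed vertex on one side only.
\<close>

lemma fixed_evens_compatible:
  assumes \<pi>: "\<pi> permutes {..<n div 2}" and \<rho>: "\<rho> permutes {..<n div 2}" and "\<pi> \<noteq> \<rho>"
  shows "cycle_compatible 4 (seq_path n (fixed_evens \<pi>)) (seq_path n (fixed_evens \<rho>))"
proof -
  let ?m = "n div 2"
  obtain i where i: "\<pi> i \<noteq> \<rho> i" using \<open>\<pi> \<noteq> \<rho>\<close> by (auto simp: fun_eq_iff)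
  \<comment> \<open>\<open>\<pi>\<close> takes the value \<open>\<rho> i\<close> elsewhere, and this is a second place of disagreement.\<close>
  define j where "j = inv \<pi> (\<rho> i)"
  have pj: "\<pi> j = \<rho> i" unfolding j_def using permutes_inverses[OF \<pi>] by simp
  have "j \<noteq> i" using i pj by auto
  then have j: "\<pi> j \<noteq> \<rho> j" using pj permutes_inj[OF \<rho>] by (auto dest: injD)
  have lt: "k < ?m" if "\<pi> k \<noteq> \<rho> k" for k
    using that permutes_not_in[OF \<pi>, of k] permutes_not_in[OF \<rho>, of k] by fastforce
  define k where "k = min i j"
  have k: "\<pi> k \<noteq> \<rho> k" "Suc k < ?m"
    using i j lt[OF i] lt[OF j] \<open>j \<noteq> i\<close> by (auto simp: k_def min_def)
  let ?a = "Suc (2 * k)" and ?b = "Suc (Suc (2 * \<pi> k))" and ?a' = "Suc (2 * Suc k)"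
    and ?b' = "Suc (Suc (2 * \<rho> k))"
  have edges: "{?a, Suc (Suc (2 * \<tau> k))} \<in> seq_path n (fixed_evens \<tau>)"
    "{Suc (Suc (2 * \<tau> k)), ?a'} \<in> seq_path n (fixed_evens \<tau>)" for \<tau>
    using seq_pathI[of "2 * k" n "fixed_evens \<tau>"] seq_pathI[of "Suc (2 * k)" n "fixed_evens \<tau>"] k(2)
    by (auto simp: fixed_evens_def)
  have ne: "?a \<noteq> ?b" "?a \<noteq> ?b'" "?a' \<noteq> ?b" "?a' \<noteq> ?b'" "?a \<noteq> ?a'" "?b \<noteq> ?b'"
    using k(1) by presburger+
  let ?S = "path_edges [?a, ?b, ?a']" and ?T = "path_edges [?a', ?b', ?a]"
  let ?C = "path_edges [?a, ?b, ?a', ?b'] \<union> {{?b', ?a}}"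
  have C: "?C = ?S \<union> ?T" unfolding path_edges_simps by blast
  have S: "subpath ?S (seq_path n (fixed_evens \<pi>))"
    unfolding subpath_def is_path_def
  proof (intro conjI exI[of _ "[?a, ?b, ?a']"])
    show "?S \<subseteq> seq_path n (fixed_evens \<pi>)" using edges[of \<pi>] by (simp add: path_edges_simps)
  qed (use ne in simp_all)
  have T: "subpath ?T (seq_path n (fixed_evens \<rho>))"
    unfolding subpath_def is_path_def
  proof (intro conjI exI[of _ "[?a', ?b', ?a]"])
    show "?T \<subseteq> seq_path n (fixed_evens \<rho>)"
      using edges[of \<rho>] by (simp add: path_edges_simps insert_commute)
  qed (use ne in simp_all)
  have disj: "?S \<inter> ?T = {}"
    using ne unfolding path_edges_simps by (simp add: doubleton_eq_iff)
  have cyc: "is_cycle 4 ?C"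
    unfolding is_cycle_def by (intro exI[of _ "[?a, ?b, ?a', ?b']"]) (use ne in auto)
  show ?thesis
    unfolding cycle_compatible_def
    using S T C cyc disj by (intro exI[of _ ?C]) (auto simp: subpath_def)
qed

lemma fact_half_le_M_hat: "fact (n div 2) \<le> M_hat n 4"
proof -
  let ?\<Pi> = "{\<pi>. \<pi> permutes {..<n div 2}}"
  let ?f = "\<lambda>\<pi>. seq_path n (fixed_evens \<pi>)"
  have inj: "inj_on ?f ?\<Pi>"
  proof (rule inj_onI)
    fix \<pi> \<rho> assume \<pi>: "\<pi> \<in> ?\<Pi>" and \<rho>: "\<rho> \<in> ?\<Pi>" and eq: "?f \<pi> = ?f \<rho>"
    have same: "fixed_evens \<pi> p = fixed_evens \<rho> p" if "p < n" for p
    proof (rule seq_path_determines_sequence[OF _ _ eq _ that])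
      show "inj (fixed_evens \<pi>)" "inj (fixed_evens \<rho>)"
        using \<pi> \<rho> fixed_evens_permutes permutes_inj by blast+
    qed (simp add: fixed_evens_def)
    show "\<pi> = \<rho>"
    proof
      fix i
      show "\<pi> i = \<rho> i"
      proof (cases "i < n div 2")
        case True
        then show ?thesis using same[of "Suc (2 * i)"] by (auto simp: fixed_evens_def)
      next
        case False
        then show ?thesis using \<pi> \<rho> by (simp add: permutes_not_in)
      qed
    qed
  qed
  have "?f ` ?\<Pi> \<in> compatible_families n 4"
    unfolding compatible_families_def
    using seq_path_hamilton fixed_evens_permutes fixed_evens_compatible by fastforce
  then have "card (?f ` ?\<Pi>) \<le> M_hat n 4" by (rule card_le_M_hat)
  also have "card (?f ` ?\<Pi>) = card ?\<Pi>" using inj by (rule card_image)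
  also have "\<dots> = fact (n div 2)" by (simp add: card_permutations)
  finally show ?thesis .
qed

section \<open>Paths with a cyclic colouring of period six\<close>

text \<open>
  A path is viewed here as the relation from each vertex to the next one in a fixed direction of
  traversal, and \<open>c\<close> is a colouring of the vertices modulo six.
\<close>

definition six_layered :: "(nat \<Rightarrow> nat) \<Rightarrow> (nat \<Rightarrow> nat \<Rightarrow> bool) \<Rightarrow> bool" where
  "six_layered c A \<longleftrightarrow>
     (\<forall>u v. A u v \<longrightarrow> c v mod 6 = Suc (c u) mod 6) \<and>
     (\<forall>u v w. A u v \<and> A u w \<longrightarrow> v = w) \<and> (\<forall>u v w. A u v \<and> A w v \<longrightarrow> u = w)"

text \<open>
  The arcs that leave a vertex of even colour are the edges inside blocks, which all paths of the
  family have in common. The condition compares arcs with a common end, because two parallel paths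
  of two edges in a 4-cycle meet in their first and last vertices.
\<close>

definition share_even_arcs :: "(nat \<Rightarrow> nat) \<Rightarrow> (nat \<Rightarrow> nat \<Rightarrow> bool) \<Rightarrow> (nat \<Rightarrow> nat \<Rightarrow> bool) \<Rightarrow> bool" where
  "share_even_arcs c A B \<longleftrightarrow>
     (\<forall>u v w. even (c u) \<and> A u v \<and> B u w \<longrightarrow> v = w) \<and>
     (\<forall>u v w. even (c u) \<and> even (c w) \<and> A u v \<and> B w v \<longrightarrow> u = w)"

lemma share_even_arcs_sym: "share_even_arcs c A B \<Longrightarrow> share_even_arcs c B A"
  unfolding share_even_arcs_def by metis

text \<open>
  After two steps forward, two further steps of \<open>\<plusminus>1\<close> lead back to the start modulo \<open>6\<close> only
  if both go backward, because the other possible sums are \<open>2\<close> and \<open>4\<close>.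
\<close>

lemma two_steps_forward_return_mod_6:
  fixes u v w x :: nat
  assumes v: "v mod 6 = Suc u mod 6" and w: "w mod 6 = Suc v mod 6"
    and wx: "x mod 6 = Suc w mod 6 \<or> w mod 6 = Suc x mod 6"
    and xu: "u mod 6 = Suc x mod 6 \<or> x mod 6 = Suc u mod 6"
  shows "x mod 6 \<noteq> Suc w mod 6" "u mod 6 \<noteq> Suc x mod 6"
proof -
  have step: "Suc p mod 6 = Suc q mod 6" if "p mod 6 = q mod 6" for p q :: nat
    using that by (metis mod_Suc_eq)
  have ne: "(u + 4) mod 6 \<noteq> u mod 6" "(u + 3) mod 6 \<noteq> Suc u mod 6" "(u + 2) mod 6 \<noteq> u mod 6"
    by (simp_all add: mod_eq_dvd_iff_nat)
  have w': "w mod 6 = (u + 2) mod 6" using w step[OF v] by simp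
  have far: "x mod 6 \<noteq> (u + 3) mod 6"
  proof
    assume x: "x mod 6 = (u + 3) mod 6"
    show False using xu
    proof
      assume "u mod 6 = Suc x mod 6"
      then show False using step[OF x] ne(1) by (simp add: add.commute)
    next
      assume "x mod 6 = Suc u mod 6"
      then show False using x ne(2) by simp
    qed
  qed
  then show 1: "x mod 6 \<noteq> Suc w mod 6" using step[OF w'] by (simp add: add.commute)
  show "u mod 6 \<noteq> Suc x mod 6" using 1 wx w' ne(3) by simp
qed
lemma parity_of_next_mod_6: fixes a b :: nat
  assumes "b mod 6 = Suc a mod 6"
  shows "even b \<longleftrightarrow> odd a"
proof -
  have "even b \<longleftrightarrow> even (b mod 6)" by (simp add: dvd_mod_iff)
  also have "\<dots> \<longleftrightarrow> even (Suc a)" unfolding assms by (simp add: dvd_mod_iff)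
  finally show ?thesis by simp
qed

text \<open>
  The two edges at \<open>x\<close> must run parallel to \<open>u, v, w\<close>. Neither is in \<open>A\<close>, which has no second arc
  out of \<open>u\<close> or into \<open>w\<close>, so both are in \<open>B\<close>. If \<open>u\<close> has even colour, the arc out of \<open>u\<close> is
  common to \<open>A\<close> and \<open>B\<close>; otherwise the arc into \<open>w\<close> is. In both cases \<open>x = v\<close>. The hypotheses
  on the edges at \<open>x\<close> leave open which relation they belong to, so the splits of a 4-cycle into two
  and two edges and into three and one are treated at once.
\<close>

lemma directed_two_path_not_in_four_cycle:
  assumes A: "six_layered c A" and B: "six_layered c B" and AB: "share_even_arcs c A B"
    and uv: "A u v" and vw: "A v w" and "v \<noteq> x"
    and wx: "A w x \<or> A x w \<or> B w x \<or> B x w"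
    and xu: "A x u \<or> A u x \<or> B x u \<or> B u x"
  shows False
proof -
  have col: "c q mod 6 = Suc (c p) mod 6" if "A p q \<or> B p q" for p q
    using that A B unfolding six_layered_def by blast
  have v: "c v mod 6 = Suc (c u) mod 6" and w: "c w mod 6 = Suc (c v) mod 6"
    using col uv vw by blast+
  have wx': "c x mod 6 = Suc (c w) mod 6 \<or> c w mod 6 = Suc (c x) mod 6" using wx col by blast
  have xu': "c u mod 6 = Suc (c x) mod 6 \<or> c x mod 6 = Suc (c u) mod 6" using xu col by blast
  have 1: "c x mod 6 \<noteq> Suc (c w) mod 6" and 2: "c u mod 6 \<noteq> Suc (c x) mod 6"
    by (rule two_steps_forward_return_mod_6[OF v w wx' xu'])+
  have "A x w \<or> B x w" "A u x \<or> B u x" using wx xu 1 2 col by blast+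
  moreover have "\<not> A x w" "\<not> A u x"
    using A uv vw \<open>v \<noteq> x\<close> unfolding six_layered_def by metis+
  ultimately have xw: "B x w" and ux: "B u x" by blast+
  show False
  proof (cases "even (c u)")
    case True
    then show False using AB uv ux \<open>v \<noteq> x\<close> unfolding share_even_arcs_def by blast
  next
    case False
    then have "even (c v)" using parity_of_next_mod_6[OF v] by simp
    moreover have "c x mod 6 = Suc (c u) mod 6" using ux col by blast
    then have "even (c x)" using False parity_of_next_mod_6 by blast
    ultimately show False using AB vw xw \<open>v \<noteq> x\<close> unfolding share_even_arcs_def by blast
  qed
qed

lemma two_path_not_in_four_cycle:
  assumes A: "six_layered c A" and B: "six_layered c B" and AB: "share_even_arcs c A B"
    and uv: "A u v \<or> A v u" and vw: "A v w \<or> A w v" and "u \<noteq> w" "v \<noteq> x"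
    and wx: "A w x \<or> A x w \<or> B w x \<or> B x w"
    and xu: "A x u \<or> A u x \<or> B x u \<or> B u x"
  shows False
proof -
  have "A u v \<and> A v w \<or> A w v \<and> A v u"
    using uv vw A \<open>u \<noteq> w\<close> unfolding six_layered_def by blast
  then show False
    using directed_two_path_not_in_four_cycle[OF A B AB, of u v w x]
      directed_two_path_not_in_four_cycle[OF A B AB, of w v u x] wx xu \<open>v \<noteq> x\<close>
    by blast
qed

text \<open>
  A path is connected; this excludes the split of a 4-cycle into its two pairs of opposite edges.
\<close>

lemma path_edges_not_two_disjoint:
  assumes d: "distinct us" and eq: "path_edges us = {e, f}"
  shows "e \<inter> f \<noteq> {}"
proof
  assume disj: "e \<inter> f = {}"
  define g where "g i = {us ! i, us ! Suc i}" for i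
  have E: "path_edges us = {g i | i. Suc i < length us}" by (simp add: path_edges_def g_def)
  have step: False if "Suc j < length us" "i < j" "{g i, g j} = {e, f}" for i j
  proof -
    have dis: "g i \<inter> g j = {}" using disj that(3) by (auto simp: doubleton_eq_iff)
    have "g (Suc i) \<in> {g i, g j}" unfolding that(3) eq[symmetric] E using that by auto
    moreover have "us ! Suc i \<in> g i \<inter> g (Suc i)" by (simp add: g_def)
    ultimately have "g (Suc i) = g i" using dis by auto
    then have "us ! Suc (Suc i) \<in> {us ! i, us ! Suc i}" by (auto simp: g_def)
    moreover have "Suc (Suc i) < length us" using that by simp
    ultimately show False using d by (auto simp: nth_eq_iff_index_eq)
  qed
  have "e \<in> path_edges us" "f \<in> path_edges us" using eq by auto
  then obtain i j where ij: "Suc i < length us" "Suc j < length us" "e = g i" "f = g j"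
    unfolding E by blast
  have "i \<noteq> j" using disj ij by (auto simp: g_def)
  then show False
    using step[of j i] step[of i j] ij by (auto simp: insert_commute neq_iff)
qed

text \<open>
  Whatever the split of a 4-cycle into two paths, two adjacent edges belong to the same part, and
  \<open>two_path_not_in_four_cycle\<close> forbids that for either part.
\<close>

lemma layered_paths_incompatible:
  assumes A: "six_layered c A" and B: "six_layered c B" and AB: "share_even_arcs c A B"
    and P: "\<And>u v. {u, v} \<in> P \<Longrightarrow> A u v \<or> A v u"
    and Q: "\<And>u v. {u, v} \<in> Q \<Longrightarrow> B u v \<or> B v u"
  shows "\<not> cycle_compatible 4 P Q"
proof
  assume "cycle_compatible 4 P Q"
  then obtain C S T where C: "is_cycle 4 C" and S: "subpath S P" and T: "subpath T Q"
    and CST: "C = S \<union> T"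
    unfolding cycle_compatible_def by blast
  obtain vs where vs: "length vs = 4" "distinct vs" "C = insert {last vs, hd vs} (path_edges vs)"
    using C unfolding is_cycle_def by blast
  then obtain a b c' d where "vs = [a, b, c', d]"
    by (auto simp: numeral_eq_Suc length_Suc_conv)
  with vs have ne: "distinct [a, b, c', d]" and C4: "C = {{a, b}, {b, c'}, {c', d}, {d, a}}"
    by (auto simp: path_edges_simps)
  have SP: "S \<subseteq> P" and TQ: "T \<subseteq> Q" using S T unfolding subpath_def by blast+
  have edge: "A u v \<or> A v u \<or> B u v \<or> B v u" if "{u, v} \<in> C" for u v
    using that P Q SP TQ unfolding CST by blast
  have BA: "share_even_arcs c B A" using AB by (rule share_even_arcs_sym)
  have turn: "\<not> ({u, v} \<in> S \<and> {v, w} \<in> S) \<and> \<not> ({u, v} \<in> T \<and> {v, w} \<in> T)"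
    if "u \<noteq> w" "v \<noteq> x" "{w, x} \<in> C" "{x, u} \<in> C" for u v w x
  proof -
    have "\<not> ({u, v} \<in> P \<and> {v, w} \<in> P)"
      using two_path_not_in_four_cycle[OF A B AB, of u v w x] that edge[OF that(3)] edge[OF that(4)]
        P by blast
    moreover have "\<not> ({u, v} \<in> Q \<and> {v, w} \<in> Q)"
      using two_path_not_in_four_cycle[OF B A BA, of u v w x] that edge[OF that(3)] edge[OF that(4)]
        Q by blast
    ultimately show ?thesis using SP TQ by blast
  qed
  have t: "\<not> ({a, b} \<in> S \<and> {b, c'} \<in> S) \<and> \<not> ({a, b} \<in> T \<and> {b, c'} \<in> T)"
    "\<not> ({b, c'} \<in> S \<and> {c', d} \<in> S) \<and> \<not> ({b, c'} \<in> T \<and> {c', d} \<in> T)"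
    "\<not> ({c', d} \<in> S \<and> {d, a} \<in> S) \<and> \<not> ({c', d} \<in> T \<and> {d, a} \<in> T)"
    "\<not> ({d, a} \<in> S \<and> {a, b} \<in> S) \<and> \<not> ({d, a} \<in> T \<and> {a, b} \<in> T)"
    by (rule turn[of a c' b d] turn[of b d c' a] turn[of c' a d b] turn[of d b a c'];
        use ne in \<open>simp add: C4\<close>)+
  have mem: "{a, b} \<in> S \<union> T" "{b, c'} \<in> S \<union> T" "{c', d} \<in> S \<union> T" "{d, a} \<in> S \<union> T"
    "S \<subseteq> {{a, b}, {b, c'}, {c', d}, {d, a}}"
    using CST C4 by auto
  \<comment> \<open>Without two adjacent edges in the same part, the parts alternate around the cycle.\<close>
  have alternate: "S = {e1, e3} \<or> S = {e2, e4}"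
    if "\<not> (e1 \<in> S \<and> e2 \<in> S) \<and> \<not> (e1 \<in> T \<and> e2 \<in> T)" "\<not> (e2 \<in> S \<and> e3 \<in> S) \<and> \<not> (e2 \<in> T \<and> e3 \<in> T)"
      "\<not> (e3 \<in> S \<and> e4 \<in> S) \<and> \<not> (e3 \<in> T \<and> e4 \<in> T)" "\<not> (e4 \<in> S \<and> e1 \<in> S) \<and> \<not> (e4 \<in> T \<and> e1 \<in> T)"
      "e1 \<in> S \<union> T" "e2 \<in> S \<union> T" "e3 \<in> S \<union> T" "e4 \<in> S \<union> T" "S \<subseteq> {e1, e2, e3, e4}"
    for e1 e2 e3 e4
  proof (cases "e1 \<in> S")
    case True
    then have "e3 \<in> S" "e2 \<notin> S" "e4 \<notin> S" using that by blast+
    then show ?thesis using True that(9) by blast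
  next
    case False
    then have "e2 \<in> S" "e4 \<in> S" "e3 \<notin> S" using that by blast+
    then show ?thesis using False that(9) by blast
  qed
  have "S = {{a, b}, {c', d}} \<or> S = {{b, c'}, {d, a}}"
    using t mem by (rule alternate)
  moreover obtain us where "distinct us" "S = path_edges us"
    using S unfolding subpath_def is_path_def by blast
  ultimately show False
    using path_edges_not_two_disjoint[of us "{a, b}" "{c', d}"]
      path_edges_not_two_disjoint[of us "{b, c'}" "{d, a}"] ne by auto
qed

section \<open>A large family of pairwise incompatible paths\<close>

definition block_permutation :: "(nat \<Rightarrow> nat) \<Rightarrow> nat \<Rightarrow> nat" where
  "block_permutation \<pi> p = 2 * \<pi> (p div 2) + p mod 2"

definition residue_preserving :: "nat \<Rightarrow> (nat \<Rightarrow> nat) set" where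
  "residue_preserving m = {\<pi>. \<pi> permutes {..<m} \<and> (\<forall>i. \<pi> i mod 3 = i mod 3)}"

lemma block_permutation_permutes:
  assumes "\<pi> permutes {..<n div 2}"
  shows "block_permutation \<pi> permutes {..<n}"
proof -
  have inv: "block_permutation \<rho> (block_permutation \<rho>' p) = p" if "\<And>i. \<rho> (\<rho>' i) = i" for \<rho> \<rho>' p
    using that by (auto simp: block_permutation_def)
  have "bij (block_permutation \<pi>)"
    by (rule o_bij[where g = "block_permutation (inv \<pi>)"])
      (auto simp: fun_eq_iff inv permutes_inverses[OF assms])
  moreover have "block_permutation \<pi> p = p" if "p \<notin> {..<n}" for p
  proof -
    have "p div 2 \<notin> {..<n div 2}" using that by auto
    then have "\<pi> (p div 2) = p div 2" using assms by (simp add: permutes_not_in)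
    then show ?thesis by (simp add: block_permutation_def)
  qed
  ultimately show ?thesis
    by (simp add: permutes_def bij_iff)
qed

lemma block_permutation_mod_6:
  assumes "\<pi> \<in> residue_preserving m"
  shows "block_permutation \<pi> p mod 6 = p mod 6"
proof -
  have "\<pi> (p div 2) mod 3 = (p div 2) mod 3" using assms by (simp add: residue_preserving_def)
  then have "2 * \<pi> (p div 2) mod (2 * 3) = 2 * (p div 2) mod (2 * 3)"
    by (metis mult_mod_right)
  then have "(2 * \<pi> (p div 2) + p mod 2) mod 6 = (2 * (p div 2) + p mod 2) mod 6"
    by (intro mod_add_cong) simp_all
  then show ?thesis unfolding block_permutation_def by simp
qed

definition arc :: "nat \<Rightarrow> (nat \<Rightarrow> nat) \<Rightarrow> nat \<Rightarrow> nat \<Rightarrow> bool" where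
  "arc n s u v \<longleftrightarrow> (\<exists>p. Suc p < n \<and> u = Suc (s p) \<and> v = Suc (s (Suc p)))"

lemma seq_path_arc: "{u, v} \<in> seq_path n s \<Longrightarrow> arc n s u v \<or> arc n s v u"
  unfolding seq_path_def arc_def by (auto simp: doubleton_eq_iff)

text \<open>
  All of the following holds for the family relabelled by an arbitrary permutation \<open>g\<close>, where the
  colour of a vertex is its label before the relabelling.
\<close>

context
  fixes n :: nat and g :: "nat \<Rightarrow> nat"
  assumes g: "g permutes {..<n}"
begin

definition label :: "nat \<Rightarrow> nat" where "label u = inv g (u - 1)"

lemma label_Suc_g [simp]: "label (Suc (g p)) = p"
  by (simp add: label_def permutes_inverses[OF g])

lemma six_layered_block:
  assumes \<pi>: "\<pi> \<in> residue_preserving (n div 2)"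
  shows "six_layered label (arc n (g \<circ> block_permutation \<pi>))"
proof -
  have "block_permutation \<pi> permutes {..<n}"
    using \<pi> by (simp add: residue_preserving_def block_permutation_permutes)
  then have inj: "g (block_permutation \<pi> p) = g (block_permutation \<pi> q) \<longleftrightarrow> p = q" for p q
    using permutes_inj g by (metis injD)
  have "Suc (block_permutation \<pi> p) mod 6 = Suc p mod 6" for p
    using block_permutation_mod_6[OF \<pi>, of p] by (metis mod_Suc_eq)
  then show ?thesis
    unfolding six_layered_def arc_def
    by (auto simp: inj block_permutation_mod_6[OF \<pi>])
qed

lemma arc_even:
  assumes "arc n (g \<circ> block_permutation \<pi>) u v" "even (label u)"
  shows "v = Suc (g (Suc (label u)))" "u = Suc (g (label u))"
proof -
  obtain p where u: "u = Suc (g (block_permutation \<pi> p))"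
    and v: "v = Suc (g (block_permutation \<pi> (Suc p)))"
    using assms(1) by (auto simp: arc_def)
  have "even p" using assms(2) by (simp add: u block_permutation_def)
  then have "block_permutation \<pi> (Suc p) = Suc (block_permutation \<pi> p)"
    by (auto simp: block_permutation_def elim: evenE)
  then show "v = Suc (g (Suc (label u)))" "u = Suc (g (label u))" by (simp_all add: u v)
qed

lemma share_even_arcs_block:
  "share_even_arcs label (arc n (g \<circ> block_permutation \<pi>)) (arc n (g \<circ> block_permutation \<rho>))"
  unfolding share_even_arcs_def
proof (intro conjI allI impI)
  fix u v w
  assume "even (label u) \<and> arc n (g \<circ> block_permutation \<pi>) u v \<and> arc n (g \<circ> block_permutation \<rho>) u w"
  then show "v = w" using arc_even by metis
next
  fix u v w
  assume *: "even (label u) \<and> even (label w) \<and>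
    arc n (g \<circ> block_permutation \<pi>) u v \<and> arc n (g \<circ> block_permutation \<rho>) w v"
  then have "g (Suc (label u)) = g (Suc (label w))" using arc_even(1) by (metis Suc_inject)
  then have "label u = label w" using permutes_inj[OF g] by (auto dest: injD)
  then show "u = w" using * arc_even(2) by metis
qed

lemma block_paths_incompatible:
  assumes "\<pi> \<in> residue_preserving (n div 2)" "\<rho> \<in> residue_preserving (n div 2)"
  shows "\<not> cycle_compatible 4 (seq_path n (g \<circ> block_permutation \<pi>))
            (seq_path n (g \<circ> block_permutation \<rho>))"
  by (rule layered_paths_incompatible[OF six_layered_block[OF assms(1)] six_layered_block[OF assms(2)]
        share_even_arcs_block]) (rule seq_path_arc, assumption)+

text \<open>
  The colours orient every edge, so the first vertex of a path is recognised as the one that no arc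
  enters; in particular a path and its reversal do not both arise.
\<close>

lemma block_paths_distinct:
  assumes \<pi>: "\<pi> \<in> residue_preserving (n div 2)" and \<rho>: "\<rho> \<in> residue_preserving (n div 2)"
    and eq: "seq_path n (g \<circ> block_permutation \<pi>) = seq_path n (g \<circ> block_permutation \<rho>)"
  shows "\<pi> = \<rho>"
proof -
  let ?s = "g \<circ> block_permutation \<pi>" and ?t = "g \<circ> block_permutation \<rho>"
  have perm: "?s permutes {..<n}" "?t permutes {..<n}"
    using \<pi> \<rho> g by (auto simp: residue_preserving_def intro: permutes_compose block_permutation_permutes)
  note inj = perm[THEN permutes_inj]
  have same: "?s p = ?t p" if "p < n" for p
  proof (rule seq_path_determines_sequence[OF inj eq _ that])
    have "0 < n" using that by simp
    then have "?s 0 \<in> ?t ` {..<n}" using permutes_image[OF perm(2)] permutes_in_image[OF perm(1)] by simp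
    then obtain q where q: "q < n" "?s 0 = ?t q" by auto
    \<comment> \<open>Otherwise the vertex before place \<open>q\<close> would be the neighbour at place \<open>1\<close> of the other sequence,
      although its colour is \<open>-1\<close> modulo \<open>6\<close>.\<close>
    have "q = 0"
    proof (cases q)
      case (Suc r)
      have "{Suc (?t r), Suc (?t (Suc r))} \<in> seq_path n ?s"
        using seq_pathI[of r n ?t] q Suc eq by simp
      then obtain k where k: "{Suc (?t r), Suc (?t (Suc r))} = {Suc (?s k), Suc (?s (Suc k))}"
        unfolding seq_path_def by blast
      have "?s (Suc k) \<noteq> ?s 0" using injD[OF inj(1), of "Suc k" 0] by blast
      then have "?t r = ?s (Suc k)" "?s k = ?s 0"
        using k q(2) Suc unfolding doubleton_eq_iff by (metis Suc_inject)+
      then have "?t r = ?s 1" using injD[OF inj(1), of k 0] by simp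
      then have 1: "block_permutation \<rho> r = block_permutation \<pi> 1"
        and 2: "block_permutation \<rho> q = block_permutation \<pi> 0"
        using q(2) injD[OF permutes_inj[OF g]] unfolding o_apply by metis+
      have "r mod 6 = 1 mod 6" "q mod 6 = 0 mod 6"
        using 1 2 block_permutation_mod_6[OF \<pi>] block_permutation_mod_6[OF \<rho>] by metis+
      then show ?thesis using Suc by (simp add: mod_Suc)
    qed simp
    with q show "?s 0 = ?t 0" by simp
  qed
  show ?thesis
  proof
    fix i
    show "\<pi> i = \<rho> i"
    proof (cases "i < n div 2")
      case True
      then have "?s (2 * i) = ?t (2 * i)" by (intro same) simp
      then have "block_permutation \<pi> (2 * i) = block_permutation \<rho> (2 * i)"
        using permutes_inj[OF g] by (auto dest: injD)
      then show ?thesis by (simp add: block_permutation_def)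
    next
      case False
      then have "i \<notin> {..<n div 2}" by simp
      then show ?thesis using \<pi> \<rho> unfolding residue_preserving_def
        by (metis (no_types, lifting) mem_Collect_eq permutes_not_in)
    qed
  qed
qed

end

lemma finite_residue_preserving: "finite (residue_preserving m)"
  by (rule finite_subset[OF _ finite_permutations[of "{..<m}"]]) (auto simp: residue_preserving_def)

text \<open>
  Composition with the inverse of one member \<open>q\<close> of a colour class \<open>?fib k\<close> maps the class
  injectively into the residue preserving permutations, and there are at most \<open>3 ^ m\<close> classes.
\<close>

lemma fact_le_card_residue_preserving: "fact m \<le> 3 ^ m * card (residue_preserving m)"
proof -
  let ?S = "{p. p permutes {..<m}}"
  let ?c = "\<lambda>p. restrict (\<lambda>i. p i mod 3) {..<m}"
  let ?K = "{..<m} \<rightarrow>\<^sub>E {..<3::nat}"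
  let ?fib = "\<lambda>k. {p \<in> ?S. ?c p = k}"
  have fib: "card (?fib k) \<le> card (residue_preserving m)" for k
  proof (cases "?fib k = {}")
    case False
    then obtain q where q: "q permutes {..<m}" and qk: "?c q = k" by blast
    have "(\<lambda>p. p \<circ> inv q) ` ?fib k \<subseteq> residue_preserving m"
    proof
      fix r assume "r \<in> (\<lambda>p. p \<circ> inv q) ` ?fib k"
      then obtain p where "p \<in> ?fib k" and r: "r = p \<circ> inv q" by (rule imageE)
      then have p: "p permutes {..<m}" "?c p = ?c q" using qk by (simp_all only: mem_Collect_eq)
      have r': "r permutes {..<m}" unfolding r by (rule permutes_compose[OF permutes_inv[OF q] p(1)])
      have "r i mod 3 = i mod 3" for i
      proof (cases "i < m")
        case True
        then have "inv q i < m" using permutes_in_image[OF permutes_inv[OF q]] by simp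
        then have "p (inv q i) mod 3 = q (inv q i) mod 3" using fun_cong[OF p(2), of "inv q i"] by simp
        then show ?thesis by (simp add: r permutes_inverses[OF q])
      next
        case False
        then show ?thesis using r' by (simp add: permutes_not_in)
      qed
      with r' show "r \<in> residue_preserving m" by (simp add: residue_preserving_def)
    qed
    moreover have "inj_on (\<lambda>p. p \<circ> inv q) (?fib k)"
    proof (rule inj_onI)
      fix p p' assume "p \<circ> inv q = p' \<circ> inv q"
      then have "p \<circ> inv q \<circ> q = p' \<circ> inv q \<circ> q" by simp
      then show "p = p'" by (simp add: o_assoc[symmetric] permutes_inv_o[OF q])
    qed
    ultimately show ?thesis by (rule card_inj_on_le[OF _ _ finite_residue_preserving, rotated])
  next
    case True
    then show ?thesis by (simp only: card.empty)
  qed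
  have K: "finite ?K" "card ?K = 3 ^ m" by (simp_all add: finite_PiE card_PiE)
  have "?S = (\<Union>k\<in>?K. ?fib k)" by fastforce
  then have "card ?S \<le> (\<Sum>k\<in>?K. card (?fib k))" using card_UN_le[OF K(1), of ?fib] by simp
  also have "\<dots> \<le> card ?K * card (residue_preserving m)"
    using sum_bounded_above[of ?K "\<lambda>k. card (?fib k)"] fib by simp
  finally show ?thesis by (simp add: K card_permutations)
qed

section \<open>The upper bound\<close>

text \<open>
  Double counting of the pairs of a relabelling \<open>g\<close> and a block arrangement \<open>\<pi>\<close> whose path belongs
  to \<open>F\<close>: there are at least \<open>card F\<close> for each \<open>\<pi>\<close> and at most one for each \<open>g\<close>.
\<close>

lemma card_family_times_card_residue_preserving_le:
  assumes F: "F \<in> compatible_families n 4"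
  shows "card F * card (residue_preserving (n div 2)) \<le> fact n"
proof -
  let ?R = "residue_preserving (n div 2)" and ?S = "{g. g permutes {..<n}}"
  let ?path = "\<lambda>g \<pi>. seq_path n (g \<circ> block_permutation \<pi>)"
  have fin: "finite ?S" "finite ?R" by (simp_all add: finite_permutations finite_residue_preserving)
  have ge: "card F \<le> card {g \<in> ?S. ?path g \<pi> \<in> F}" if "\<pi> \<in> ?R" for \<pi>
  proof (rule surj_card_le)
    show "F \<subseteq> (\<lambda>g. ?path g \<pi>) ` {g \<in> ?S. ?path g \<pi> \<in> F}"
    proof
      fix P assume "P \<in> F"
      then have "P \<in> hamilton_paths n" using F unfolding compatible_families_def by blast
      then obtain s where s: "s permutes {..<n}" "P = seq_path n s"
        by (rule hamilton_path_obtains_permutation)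
      let ?b = "block_permutation \<pi>"
      have b: "?b permutes {..<n}"
        using that by (simp add: residue_preserving_def block_permutation_permutes)
      have "s \<circ> inv ?b \<circ> ?b = s" by (simp add: o_assoc[symmetric] permutes_inv_o[OF b])
      moreover have "s \<circ> inv ?b \<in> ?S" using permutes_compose[OF permutes_inv[OF b] s(1)] by simp
      ultimately show "P \<in> (\<lambda>g. ?path g \<pi>) ` {g \<in> ?S. ?path g \<pi> \<in> F}"
        using s(2) \<open>P \<in> F\<close> by (intro image_eqI[of _ _ "s \<circ> inv ?b"]) auto
    qed
  qed (use fin in simp)
  have le: "card {\<pi> \<in> ?R. ?path g \<pi> \<in> F} \<le> 1" if "g \<in> ?S" for g
  proof -
    have g: "g permutes {..<n}" using that by simp
    have "\<pi> = \<rho>" if "\<pi> \<in> ?R" "\<rho> \<in> ?R" "?path g \<pi> \<in> F" "?path g \<rho> \<in> F" for \<pi> \<rho>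
      using block_paths_incompatible[OF g that(1,2)] block_paths_distinct[OF g that(1,2)] that(3,4) F
      unfolding compatible_families_def by blast
    then show ?thesis using fin(2) by (auto simp: card_le_Suc0_iff_eq)
  qed
  have "card F * card ?R = (\<Sum>\<pi>\<in>?R. card F)" by simp
  also have "\<dots> \<le> (\<Sum>\<pi>\<in>?R. card {g \<in> ?S. ?path g \<pi> \<in> F})" by (rule sum_mono) (rule ge)
  also have "\<dots> = (\<Sum>g\<in>?S. card {\<pi> \<in> ?R. ?path g \<pi> \<in> F})"
    using sum.swap_restrict[OF fin(2) fin(1), of "\<lambda>_ _. 1::nat" "\<lambda>\<pi> g. ?path g \<pi> \<in> F"] by simp
  also have "\<dots> \<le> (\<Sum>g\<in>?S. 1)" by (rule sum_mono) (rule le)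
  also have "\<dots> = fact n" by (simp add: card_permutations)
  finally show ?thesis .
qed

lemma M_hat_le: "M_hat n 4 \<le> 2 ^ n * 3 ^ (n div 2) * fact (n - n div 2)"
proof -
  let ?m = "n div 2"
  obtain F where F: "F \<in> compatible_families n 4" "card F = M_hat n 4"
    using M_hat_attained by blast
  have "M_hat n 4 * fact ?m \<le> M_hat n 4 * (3 ^ ?m * card (residue_preserving ?m))"
    using fact_le_card_residue_preserving by simp
  also have "\<dots> = 3 ^ ?m * (card F * card (residue_preserving ?m))" using F(2) by simp
  also have "\<dots> \<le> 3 ^ ?m * fact n"
    using card_family_times_card_residue_preserving_le[OF F(1)] by simp
  also have "\<dots> = 3 ^ ?m * (fact ?m * fact (n - ?m) * (n choose ?m))"
    using binomial_fact_lemma[of ?m n] by simp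
  also have "\<dots> \<le> 3 ^ ?m * (fact ?m * fact (n - ?m) * 2 ^ n)"
    by (intro mult_le_mono binomial_le_pow2 order_refl)
  finally have "M_hat n 4 * fact ?m \<le> (2 ^ n * 3 ^ ?m * fact (n - ?m)) * fact ?m"
    by (simp add: mult_ac)
  then show ?thesis by simp
qed

theorem theorem1:
  fixes n :: nat
  assumes "n \<ge> 1"
  shows "fact (nat \<lfloor>real n / 2\<rfloor>) \<le> real (M_hat n 4) \<and>
         real (M_hat n 4) \<le> (2 * sqrt 3) ^ n * fact (nat \<lceil>real n / 2\<rceil>)"
proof
  have floor: "nat \<lfloor>real n / 2\<rfloor> = n div 2"
    using floor_divide_of_nat_eq[of n 2, where ?'a = real] by simp
  have ceil: "nat \<lceil>real n / 2\<rceil> = n - n div 2" by linarith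
  show "fact (nat \<lfloor>real n / 2\<rfloor>) \<le> real (M_hat n 4)"
    unfolding floor using fact_half_le_M_hat[of n] by (metis of_nat_fact of_nat_le_iff)
  have "(3::real) ^ (n div 2) = sqrt 3 ^ (2 * (n div 2))" by (simp add: power_mult)
  also have "\<dots> \<le> sqrt 3 ^ n" by (rule power_increasing) auto
  finally have sqrt: "(3::real) ^ (n div 2) \<le> sqrt 3 ^ n" .
  have "real (M_hat n 4) \<le> real (2 ^ n * 3 ^ (n div 2) * fact (n - n div 2))"
    using M_hat_le[of n] by (simp only: of_nat_le_iff)
  also have "\<dots> = 2 ^ n * 3 ^ (n div 2) * fact (n - n div 2)" by simp
  also have "\<dots> \<le> 2 ^ n * sqrt 3 ^ n * fact (n - n div 2)"
    using sqrt by (intro mult_right_mono mult_left_mono) auto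
  finally show "real (M_hat n 4) \<le> (2 * sqrt 3) ^ n * fact (nat \<lceil>real n / 2\<rceil>)"
    unfolding ceil by (simp add: power_mult_distrib)
qed

end
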